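(* Let $k\geq 1$ be an integer. For any integers $\delta$ and $\Delta$ such that $\Delta\geq \delta\geq k+2$, there exists an infinite family $\mathcal{F}$ of (pairwise non-isomorphic) graphs with minimum degree $\delta$ and maximum degree $\Delta$, such that for every graph $G\in \mathcal{F}$, $$\gamma^{t}_{kS}(G) = |V(G)|\cdot\frac{\delta-\Delta+2k+2-I_{\delta}-I_{\Delta}}{\delta+\Delta+I_{\Delta}-I_{\delta}}\;.$$
   Context: All graphs are finite, simple and undirected, with nonempty vertex set. For each integer $n$, $I_n=1$ if $n\equiv k\pmod 2$, and $I_n=0$ otherwise. For a vertex $v$ of $G$, $N_G(v)$ denotes the open neighborhood of $v$ (the set of vertices adjacent to $v$). For $G$ of minimum degree at least $k$, a function $f:V(G)\rightarrow\{-1,1\}$ is a signed total $k$-dominating function of $G$ if $\sum_{u\in N_G(v)}f(u)\geq k$ for all $v\in V(G)$. The signed total $k$-domination number $\gamma^{t}_{kS}(G)$ is the minimum of $\sum_{v\in V(G)}f(v)$ over all signed total $k$-dominating functions $f$ of $G$. *)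

theory Defs
  imports
    Complex_Main
    "HOL-Number_Theory.Cong"
    "Graph_Theory.Pair_Digraph"
    "Graph_Theory.Digraph_Isomorphism"
begin

text \<open>
  A finite simple undirected graph is a \<^locale>\<open>pair_graph\<close>: a finite vertex set together with a
  symmetric, irreflexive arc relation on it, so that each edge \<open>{u, v}\<close> is represented by the two
  arcs \<open>(u, v)\<close> and \<open>(v, u)\<close>. Accordingly, the degree of a vertex is its \<^const>\<open>out_degree\<close>
  (which equals its \<^const>\<open>in_degree\<close>). Note that \<^locale>\<open>pair_graph\<close> admits the empty vertex set,
  which has to be excluded separately.
\<close>

definition nbhd :: "'a pair_pre_digraph \<Rightarrow> 'a \<Rightarrow> 'a set" where
  "nbhd G v = {u \<in> pverts G. (v, u) \<in> parcs G}"

definition min_degree :: "'a pair_pre_digraph \<Rightarrow> nat" where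
  "min_degree G = Min (out_degree (with_proj G) ` pverts G)"

definition max_degree :: "'a pair_pre_digraph \<Rightarrow> nat" where
  "max_degree G = Max (out_degree (with_proj G) ` pverts G)"

definition graph_isomorphic :: "'a pair_pre_digraph \<Rightarrow> 'b pair_pre_digraph \<Rightarrow> bool" where
  "graph_isomorphic G H \<longleftrightarrow> digraph_iso (with_proj G) (with_proj H)"

definition parity_ind :: "int \<Rightarrow> int \<Rightarrow> int" where
  "parity_ind k n = (if [n = k] (mod 2) then 1 else 0)"

definition signed_total_dominating :: "int \<Rightarrow> 'a pair_pre_digraph \<Rightarrow> ('a \<Rightarrow> int) \<Rightarrow> bool" where
  "signed_total_dominating k G f \<longleftrightarrow>
     (\<forall>v \<in> pverts G. f v \<in> {-1, 1}) \<and> (\<forall>v \<in> pverts G. (\<Sum>u \<in> nbhd G v. f u) \<ge> k)"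

text \<open>
  Only meaningful for nonempty \<open>G\<close> of minimum degree at least \<open>k\<close>: then the constant function 1 is
  signed total \<open>k\<close>-dominating, and the set of weights below is finite and nonempty. Values of \<open>f\<close>
  outside \<open>pverts G\<close> are unconstrained, but do not affect the weight.
\<close>

definition signed_total_domination_number :: "int \<Rightarrow> 'a pair_pre_digraph \<Rightarrow> int" where
  "signed_total_domination_number k G =
     Min {\<Sum>v \<in> pverts G. f v | f. signed_total_dominating k G f}"

end

theory Submission
  imports Defs
begin

text \<open>
  For a signed total \<open>k\<close>-dominating function let \<open>P\<close>, \<open>M\<close> be the vertices of value \<open>1\<close>, \<open>-1\<close>.
  By parity, every vertex has at least \<open>a = (\<delta> + k + 1 - I\<^sub>\<delta>) / 2\<close> neighbours in \<open>P\<close> and at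
  most \<open>b = (\<Delta> - k - 1 + I\<^sub>\<Delta>) / 2\<close> neighbours in \<open>M\<close>, so counting the edges between \<open>M\<close> and \<open>P\<close>
  gives \<open>\<bar>M\<bar> a \<le> \<bar>P\<bar> b\<close>, which is the claimed lower bound. Equality holds as soon as every vertex
  of \<open>M\<close> has degree \<open>\<delta>\<close> and exactly \<open>a\<close> neighbours in \<open>P\<close>, and every vertex of \<open>P\<close> has degree
  \<open>\<Delta>\<close> and exactly \<open>b\<close> neighbours in \<open>M\<close>. Such a graph arises from \<open>t\<close> disjoint copies of
  \<open>K\<^bsub>a,b\<^esub>\<close> by joining the \<open>t\<close> copies of each vertex of \<open>K\<^bsub>a,b\<^esub>\<close> by a regular graph,
  for which a disjoint union of balanced complete bipartite graphs is taken.
\<close>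

section \<open>The lower bound\<close>

definition nbhd_with :: "'a pair_pre_digraph \<Rightarrow> ('a \<Rightarrow> int) \<Rightarrow> int \<Rightarrow> 'a \<Rightarrow> 'a set" where
  "nbhd_with G f s v = {u \<in> nbhd G v. f u = s}"

lemma nbhd_subset: "nbhd G v \<subseteq> pverts G"
  by (auto simp: nbhd_def)

lemma (in pair_wf_digraph) out_degree_eq_card_nbhd: "out_degree (with_proj G) v = card (nbhd G v)"
proof -
  have "out_arcs (with_proj G) v = Pair v ` nbhd G v"
    by (auto simp: out_arcs_def nbhd_def image_iff dest: wellformed')
  then show ?thesis
    by (simp add: out_degree_def card_image inj_on_def)
qed

lemma (in pair_graph) finite_nbhd: "finite (nbhd G v)"
  using nbhd_subset pair_finite_verts by (rule finite_subset)

section \<open>Counting by sign, and the weight\<close>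

lemma card_sum_sign:
  fixes f :: "'a \<Rightarrow> int"
  assumes "finite A" and "f ` A \<subseteq> {-1, 1}"
  shows "card A = card {v \<in> A. f v = 1} + card {v \<in> A. f v = -1}"
    and "sum f A = int (card {v \<in> A. f v = 1}) - int (card {v \<in> A. f v = -1})"
proof -
  have A: "A = {v \<in> A. f v = 1} \<union> {v \<in> A. f v = -1}" (is "_ = ?P \<union> ?M")
    using assms(2) by auto
  have fin: "finite ?P" "finite ?M" and disj: "?P \<inter> ?M = {}"
    using assms(1) by auto
  show "card A = card ?P + card ?M"
    using card_Un_disjoint[OF fin disj] A by simp
  have "sum f A = sum f ?P + sum f ?M"
    using sum.union_disjoint[OF fin disj, of f] A by simp
  then show "sum f A = int (card ?P) - int (card ?M)"
    by simp
qed

text \<open>Both sums count the arcs from one sign class to the other; reversing arcs matches the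
  two counts.\<close>

lemma (in pair_graph) double_count:
  "(\<Sum>v | v \<in> pverts G \<and> f v = s. card (nbhd_with G f r v)) =
   (\<Sum>v | v \<in> pverts G \<and> f v = r. card (nbhd_with G f s v))"
proof -
  let ?S = "\<lambda>s r. Sigma {v. v \<in> pverts G \<and> f v = s} (nbhd_with G f r)"
  have sym: "(v, u) \<in> parcs G" if "(u, v) \<in> parcs G" for u v
    using pair_sym_arcs that by (auto simp: symmetric_def elim: symE)
  have sum_eq: "(\<Sum>v | v \<in> pverts G \<and> f v = s. card (nbhd_with G f r v)) = card (?S s r)" for s r
    using pair_finite_verts finite_nbhd by (intro card_SigmaI[symmetric]) (auto simp: nbhd_with_def)
  have "?S r s = prod.swap ` ?S s r"
    by (auto simp: nbhd_with_def nbhd_def image_iff intro: sym)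
  then have "card (?S r s) = card (?S s r)"
    by (simp add: card_image)
  with sum_eq show ?thesis
    by simp
qed

text \<open>Isolates the defect \<open>\<bar>P\<bar> * b - \<bar>M\<bar> * a\<close>: its sign
  yields the lower bound, its vanishing yields equality.\<close>

lemma (in pair_graph) weight_eq:
  assumes "f ` pverts G \<subseteq> {-1, 1}"
  shows "(\<Sum>v\<in>pverts G. f v) * (a + b) = int (card (pverts G)) * (a - b) +
    2 * (int (card {v \<in> pverts G. f v = 1}) * b - int (card {v \<in> pverts G. f v = -1}) * a)"
  unfolding card_sum_sign[OF pair_finite_verts assms] by (simp add: algebra_simps)

text \<open>If \<open>p\<close> and \<open>m\<close> count the neighbours of signs 1 and -1, then
  \<open>p + m \<ge> \<delta>\<close> and \<open>p - m \<ge> k\<close> give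
  \<open>2 * p \<ge> 2 * a - 1\<close>, hence \<open>p \<ge> a\<close> by integrality; likewise
  \<open>m \<le> b\<close>. The \<open>+ 1\<close> in both hypotheses is this rounding
  slack.\<close>

lemma (in pair_graph) weight_lower_bound:
  fixes a b :: nat
  assumes std: "signed_total_dominating k G f"
    and deg: "\<And>v. v \<in> pverts G \<Longrightarrow> \<delta> \<le> int (card (nbhd G v)) \<and> int (card (nbhd G v)) \<le> \<Delta>"
    and a: "2 * int a \<le> \<delta> + k + 1" and b: "\<Delta> \<le> 2 * int b + k + 1"
  shows "int (card (pverts G)) * (int a - int b) \<le> (\<Sum>v\<in>pverts G. f v) * (int a + int b)"
proof -
  let ?P = "{v. v \<in> pverts G \<and> f v = 1}" and ?M = "{v. v \<in> pverts G \<and> f v = -1}"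
  have sgn: "f ` pverts G \<subseteq> {-1, 1}"
    using std by (auto simp: signed_total_dominating_def)
  have loc: "a \<le> card (nbhd_with G f 1 v) \<and> card (nbhd_with G f (-1) v) \<le> b"
    if v: "v \<in> pverts G" for v
  proof -
    have "f ` nbhd G v \<subseteq> {-1, 1}"
      using sgn nbhd_subset[of G v] by blast
    note * = card_sum_sign[OF finite_nbhd this, folded nbhd_with_def]
    have "k \<le> sum f (nbhd G v)"
      using std v by (auto simp: signed_total_dominating_def)
    with * deg[OF v] a b show ?thesis
      by linarith
  qed
  have "card ?M * a \<le> (\<Sum>v\<in>?M. card (nbhd_with G f 1 v))"
    using sum_bounded_below[of ?M a "\<lambda>v. card (nbhd_with G f 1 v)"] loc by simp
  also have "\<dots> = (\<Sum>v\<in>?P. card (nbhd_with G f (-1) v))"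
    by (rule double_count)
  also have "\<dots> \<le> card ?P * b"
    using sum_bounded_above[of ?P "\<lambda>v. card (nbhd_with G f (-1) v)" b] loc by simp
  finally have "int (card ?M * a) \<le> int (card ?P * b)"
    by (rule of_nat_mono)
  then show ?thesis
    using weight_eq[OF sgn, of "int a" "int b"] by simp
qed

lemma (in pair_graph) weight_biregular:
  fixes a b :: nat
  assumes sgn: "f ` pverts G \<subseteq> {-1, 1}"
    and M: "\<And>v. v \<in> pverts G \<Longrightarrow> f v = -1 \<Longrightarrow> card (nbhd_with G f 1 v) = a"
    and P: "\<And>v. v \<in> pverts G \<Longrightarrow> f v = 1 \<Longrightarrow> card (nbhd_with G f (-1) v) = b"
  shows "(\<Sum>v\<in>pverts G. f v) * (int a + int b) = int (card (pverts G)) * (int a - int b)"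
proof -
  have "card {v. v \<in> pverts G \<and> f v = -1} * a = card {v. v \<in> pverts G \<and> f v = 1} * b"
    using double_count[of f "-1" 1] M P by simp
  from arg_cong[OF this, of int]
  have "int (card {v. v \<in> pverts G \<and> f v = -1}) * int a =
      int (card {v. v \<in> pverts G \<and> f v = 1}) * int b"
    by simp
  then show ?thesis
    using weight_eq[OF sgn, of "int a" "int b"] by simp
qed

lemma (in pair_graph) signed_total_domination_number_eqI:
  assumes "signed_total_dominating k G f"
    and least: "\<And>g. signed_total_dominating k G g \<Longrightarrow> (\<Sum>v\<in>pverts G. f v) \<le> (\<Sum>v\<in>pverts G. g v)"
  shows "signed_total_domination_number k G = (\<Sum>v\<in>pverts G. f v)"
  unfolding signed_total_domination_number_def
proof (rule Min_eqI)
  let ?n = "int (card (pverts G))"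
  \<comment> \<open>\<open>Min\<close> needs a finite set. There may be infinitely many
    \<open>g\<close>, free outside \<open>pverts G\<close>, but their weights lie in a bounded
    integer interval.\<close>
  have "(\<Sum>v\<in>pverts G. g v) \<in> {- ?n..?n}" if "signed_total_dominating k G g" for g
  proof -
    have "g ` pverts G \<subseteq> {-1, 1}"
      using that by (auto simp: signed_total_dominating_def)
    from card_sum_sign[OF pair_finite_verts this] show ?thesis
      by simp
  qed
  then show "finite {\<Sum>v\<in>pverts G. g v | g. signed_total_dominating k G g}"
    by (intro finite_subset[OF _ finite_atLeastAtMost_int[of "- ?n" ?n]]) blast
qed (use assms in auto)

text \<open>Here \<open>c\<close> and \<open>d\<close> are the degrees inside the two sign classes.
  Neighbourhood sums are \<open>a - c\<close> or \<open>d - b\<close>: being at least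
  \<open>k\<close> makes \<open>f\<close> dominating, being at most \<open>k + 1\<close> is what the
  lower bound asks of \<open>a\<close> and \<open>b\<close> for degrees between \<open>a + c\<close>
  and \<open>b + d\<close>.\<close>

lemma (in pair_graph) signed_total_domination_number_biregular:
  fixes a b c d :: nat
  assumes sgn: "f ` pverts G \<subseteq> {-1, 1}"
    and M: "\<And>v. v \<in> pverts G \<Longrightarrow> f v = -1 \<Longrightarrow>
      card (nbhd_with G f 1 v) = a \<and> card (nbhd_with G f (-1) v) = c"
    and P: "\<And>v. v \<in> pverts G \<Longrightarrow> f v = 1 \<Longrightarrow>
      card (nbhd_with G f 1 v) = d \<and> card (nbhd_with G f (-1) v) = b"
    and a: "k \<le> int a - int c" "int a - int c \<le> k + 1"
    and b: "k \<le> int d - int b" "int d - int b \<le> k + 1"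
    and le: "a + c \<le> b + d" and pos: "a > 0"
  shows "signed_total_domination_number k G * (int a + int b) =
    int (card (pverts G)) * (int a - int b)"
proof -
  have cases: "f v = -1 \<or> f v = 1" if "v \<in> pverts G" for v
    using sgn that by auto
  have "f ` nbhd G v \<subseteq> {-1, 1}" for v
    using sgn nbhd_subset[of G v] by blast
  note loc = card_sum_sign[OF finite_nbhd this, folded nbhd_with_def]
  have "k \<le> sum f (nbhd G v)" if "v \<in> pverts G" for v
    using cases[OF that] M[OF that] P[OF that] loc(2)[of v] a b by auto
  then have dom: "signed_total_dominating k G f"
    using cases by (auto simp: signed_total_dominating_def)
  have deg: "int (a + c) \<le> int (card (nbhd G v)) \<and> int (card (nbhd G v)) \<le> int (b + d)"
    if "v \<in> pverts G" for v
    using cases[OF that] M[OF that] P[OF that] loc(1)[of v] le by auto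
  have weight: "(\<Sum>v\<in>pverts G. f v) * (int a + int b) = int (card (pverts G)) * (int a - int b)"
    using M P by (intro weight_biregular sgn) auto
  have "(\<Sum>v\<in>pverts G. f v) \<le> (\<Sum>v\<in>pverts G. g v)" if "signed_total_dominating k G g" for g
  proof -
    have "(\<Sum>v\<in>pverts G. f v) * (int a + int b) \<le> (\<Sum>v\<in>pverts G. g v) * (int a + int b)"
      unfolding weight using a b by (intro weight_lower_bound[OF that deg]) auto
    then show ?thesis
      using pos by (simp add: mult_le_cancel_right)
  qed
  with dom weight show ?thesis
    by (simp add: signed_total_domination_number_eqI)
qed

section \<open>The extremal graphs\<close>

text \<open>
  Adjacency in the disjoint union of the complete bipartite graphs \<open>K\<^bsub>d,d\<^esub>\<close> between the even
  and the odd numbers of the intervals \<open>{2dq..<2d(q+1)}\<close>.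
\<close>

definition block_adj :: "nat \<Rightarrow> nat \<Rightarrow> nat \<Rightarrow> bool" where
  "block_adj d x y \<longleftrightarrow> x div (2 * d) = y div (2 * d) \<and> odd (x + y)"

lemma block_adj_sym: "block_adj d x y \<longleftrightarrow> block_adj d y x"
  by (auto simp: block_adj_def)

lemma block_adj_irrefl: "\<not> block_adj d x x"
  by (simp add: block_adj_def)

lemma div_eq_iff_atLeastLessThan: "{z. z div d = q} = {q * d..<q * d + d}" if "0 < d" for d q :: nat
  using that by (auto simp: div_nat_eqI mult.commute dividend_less_times_div add.commute)

lemma card_block_adj:
  assumes "0 < d"
  shows "card {y. block_adj d x y} = d"
proof -
  \<comment> \<open>The parity opposite to that of \<open>x\<close>; it leaves
    \<open>y div 2\<close> as the only freedom in a neighbour \<open>y\<close>, within a block of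
    length \<open>d\<close>.\<close>
  define e where "e = (if even x then 1 else 0 :: nat)"
  have "{y. block_adj d x y} = (\<lambda>z. 2 * z + e) ` {z. z div d = x div (2 * d)}"
  proof (intro equalityI subsetI)
    fix y assume "y \<in> {y. block_adj d x y}"
    then have "y = 2 * (y div 2) + e" and "y div 2 div d = x div (2 * d)"
      by (auto simp: block_adj_def e_def div_mult2_eq)
    then show "y \<in> (\<lambda>z. 2 * z + e) ` {z. z div d = x div (2 * d)}"
      by blast
  qed (auto simp: block_adj_def e_def div_mult2_eq split: if_splits)
  moreover have "inj_on (\<lambda>z. 2 * z + e) {z. z div d = x div (2 * d)}"
    by (auto simp: inj_on_def)
  ultimately show ?thesis
    using assms by (simp add: card_image div_eq_iff_atLeastLessThan)
qed

text \<open>Divisibility makes \<open>{..<t}\<close> a union of whole blocks. For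
  \<open>d = 0\<close> it forces \<open>t = 0\<close>, contradicting \<open>x < t\<close>.\<close>

lemma block_adj_less:
  assumes "block_adj d x y" and "x < t" and "2 * d dvd t"
  shows "y < t"
proof (cases "d = 0")
  case False
  from assms(3) obtain s where t: "t = s * (2 * d)"
    by (auto simp: dvd_def mult.commute)
  then have "x div (2 * d) < s"
    using assms(2) by (simp add: less_mult_imp_div_less)
  with assms(1) False show ?thesis
    by (simp add: t block_adj_def div_less_iff_less_mult)
qed (use assms in auto)

section \<open>Product coordinates and the graphs built on them\<close>

lemma card_div_mod_prod:
  fixes n :: nat
  assumes "I \<subseteq> {..<n}"
  shows "card {w. w mod n \<in> I \<and> w div n \<in> X} = card I * card X"
proof -
  have "bij_betw (\<lambda>w. (w mod n, w div n)) {w. w mod n \<in> I \<and> w div n \<in> X} (I \<times> X)"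
  proof (rule bij_betw_byWitness[where f' = "\<lambda>(i, x). i + n * x"])
    show "(\<lambda>(i, x). i + n * x) ` (I \<times> X) \<subseteq> {w. w mod n \<in> I \<and> w div n \<in> X}"
      using assms by (force simp: subset_iff)
    show "\<forall>p\<in>I \<times> X. (\<lambda>w. (w mod n, w div n)) ((\<lambda>(i, x). i + n * x) p) = p"
      using assms by (force simp: subset_iff)
  qed auto
  then show ?thesis
    by (simp add: bij_betw_same_card[of _ _ "I \<times> X"] card_cartesian_product)
qed

text \<open>
  The number \<open>v\<close> encodes copy \<open>v div (a + b)\<close> of the vertex \<open>v mod (a + b)\<close> of \<open>K\<^bsub>a,b\<^esub>\<close>, whose
  two sides are \<open>{..<a}\<close> and \<open>{a..<a + b}\<close>.
\<close>

definition extremal_adj :: "nat \<Rightarrow> nat \<Rightarrow> nat \<Rightarrow> nat \<Rightarrow> nat \<Rightarrow> nat \<Rightarrow> bool" where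
  "extremal_adj a b c d v w \<longleftrightarrow>
     v div (a + b) = w div (a + b) \<and> (v mod (a + b) < a) \<noteq> (w mod (a + b) < a) \<or>
     v mod (a + b) = w mod (a + b) \<and>
       block_adj (if v mod (a + b) < a then d else c) (v div (a + b)) (w div (a + b))"

definition extremal_graph :: "nat \<Rightarrow> nat \<Rightarrow> nat \<Rightarrow> nat \<Rightarrow> nat \<Rightarrow> nat pair_pre_digraph" where
  "extremal_graph a b c d t =
     \<lparr>pverts = {..<(a + b) * t},
      parcs = {(v, w). v < (a + b) * t \<and> w < (a + b) * t \<and> extremal_adj a b c d v w}\<rparr>"

text \<open>The side of size \<open>a\<close> is positive, so a negative vertex sees exactly
  \<open>a\<close> positive vertices in its copy of the complete bipartite graph.\<close>

definition extremal_sign :: "nat \<Rightarrow> nat \<Rightarrow> nat \<Rightarrow> int" where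
  "extremal_sign a b v = (if v mod (a + b) < a then 1 else -1)"

lemma pverts_extremal_graph [simp]: "pverts (extremal_graph a b c d t) = {..<(a + b) * t}"
  by (simp add: extremal_graph_def)

lemma pair_graph_extremal_graph: "pair_graph (extremal_graph a b c d t)"
proof
  let ?G = "extremal_graph a b c d t"
  show "finite (parcs ?G)"
    by (rule finite_subset[of _ "{..<(a + b) * t} \<times> {..<(a + b) * t}"])
      (auto simp: extremal_graph_def)
  show "symmetric (with_proj ?G)"
    by (auto simp: symmetric_def sym_def extremal_graph_def extremal_adj_def block_adj_sym)
qed (auto simp: extremal_graph_def extremal_adj_def block_adj_irrefl)

text \<open>Cutting the vertex set off at \<open>(a + b) * t\<close> loses no edge: bipartite edges
  keep the copy number, and block edges stay below \<open>t\<close>.\<close>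

lemma extremal_adj_less:
  assumes "v < (a + b) * t" and "extremal_adj a b c d v w" and "2 * c dvd t" and "2 * d dvd t"
  shows "w < (a + b) * t"
proof -
  have pos: "0 < a + b"
    using assms(1) by (cases "a + b = 0") auto
  have "v div (a + b) < t"
    using assms(1) by (simp add: less_mult_imp_div_less mult.commute)
  then have "w div (a + b) < t"
    using assms(2-4) by (auto simp: extremal_adj_def dest: block_adj_less split: if_splits)
  then show ?thesis
    using pos by (simp add: div_less_iff_less_mult mult.commute)
qed

lemma nbhd_extremal_graph:
  assumes "v < (a + b) * t" and "2 * c dvd t" and "2 * d dvd t"
  shows "nbhd (extremal_graph a b c d t) v = {w. extremal_adj a b c d v w}"
  using assms extremal_adj_less[OF assms(1) _ assms(2,3)]
  by (auto simp: nbhd_def extremal_graph_def)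

text \<open>Each of the four sets is a rectangle in the coordinates
  \<open>(w mod (a + b), w div (a + b))\<close>: opposite-sign neighbours share the copy number,
  same-sign ones share the base vertex.\<close>

lemma card_nbhd_with_extremal_graph:
  fixes a b c d t :: nat
  defines "N \<equiv> nbhd_with (extremal_graph a b c d t) (extremal_sign a b)"
  assumes v: "v < (a + b) * t" and c: "0 < c" "2 * c dvd t" and d: "0 < d" "2 * d dvd t"
  shows "extremal_sign a b v = -1 \<Longrightarrow> card (N 1 v) = a \<and> card (N (-1) v) = c"
    and "extremal_sign a b v = 1 \<Longrightarrow> card (N 1 v) = d \<and> card (N (-1) v) = b"
proof -
  let ?n = "a + b"
  have n: "0 < ?n"
    using v by (cases "?n = 0") auto
  have lt: "w mod ?n < ?n" for w
    using n by simp
  have subset: "{..<a} \<subseteq> {..<?n}" "{a..<?n} \<subseteq> {..<?n}" "{v mod ?n} \<subseteq> {..<?n}"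
    using lt by auto
  have N: "N s v = {w. extremal_adj a b c d v w \<and> extremal_sign a b w = s}" for s
    by (auto simp: N_def nbhd_with_def nbhd_extremal_graph[OF v c(2) d(2)])
  {
    assume "extremal_sign a b v = -1"
    then have v': "\<not> v mod ?n < a"
      by (auto simp: extremal_sign_def split: if_splits)
    have "N 1 v = {w. w mod ?n \<in> {..<a} \<and> w div ?n \<in> {v div ?n}}"
      using v' by (auto simp: N extremal_adj_def extremal_sign_def split: if_splits)
    moreover have "N (-1) v = {w. w mod ?n \<in> {v mod ?n} \<and> w div ?n \<in> {y. block_adj c (v div ?n) y}}"
      using v' by (auto simp: N extremal_adj_def extremal_sign_def split: if_splits)
    ultimately show "card (N 1 v) = a \<and> card (N (-1) v) = c"
      using c lt by (simp only: subset card_div_mod_prod card_block_adj) simp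
  }
  {
    assume "extremal_sign a b v = 1"
    then have v': "v mod ?n < a"
      by (auto simp: extremal_sign_def split: if_splits)
    have "N (-1) v = {w. w mod ?n \<in> {a..<?n} \<and> w div ?n \<in> {v div ?n}}"
      using v' lt by (auto simp: N extremal_adj_def extremal_sign_def not_less split: if_splits)
    moreover have "N 1 v = {w. w mod ?n \<in> {v mod ?n} \<and> w div ?n \<in> {y. block_adj d (v div ?n) y}}"
      using v' by (auto simp: N extremal_adj_def extremal_sign_def split: if_splits)
    ultimately show "card (N 1 v) = d \<and> card (N (-1) v) = b"
      using d lt by (simp only: subset card_div_mod_prod card_block_adj) simp
  }
qed

lemma degrees_extremal_graph:
  assumes a: "0 < a" and b: "0 < b" and c: "0 < c" "2 * c dvd t" and d: "0 < d" "2 * d dvd t"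
    and t: "0 < t"
  shows "out_degree (with_proj (extremal_graph a b c d t)) ` {..<(a + b) * t} = {a + c, b + d}"
proof -
  interpret pair_graph "extremal_graph a b c d t"
    by (rule pair_graph_extremal_graph)
  have deg: "out_degree (with_proj (extremal_graph a b c d t)) v =
      (if v mod (a + b) < a then b + d else a + c)" if v: "v < (a + b) * t" for v
  proof -
    have "out_degree (with_proj (extremal_graph a b c d t)) v =
        card (nbhd_with (extremal_graph a b c d t) (extremal_sign a b) 1 v) +
        card (nbhd_with (extremal_graph a b c d t) (extremal_sign a b) (-1) v)"
      unfolding out_degree_eq_card_nbhd nbhd_with_def
      by (intro card_sum_sign(1) finite_nbhd) (auto simp: extremal_sign_def)
    then show ?thesis
      using card_nbhd_with_extremal_graph[OF v c d] by (auto simp: extremal_sign_def)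
  qed
  \<comment> \<open>Vertices \<open>0\<close> and \<open>a\<close> lie on opposite sides and so
    realise both degrees; they must be in range.\<close>
  have "a + b \<le> (a + b) * t"
    using t by (cases t) auto
  moreover have "a < a + b"
    using b by simp
  ultimately have "a < (a + b) * t"
    by (rule less_le_trans[rotated])
  then have "0 < (a + b) * t"
    by (rule le_less_trans[OF le0])
  then show ?thesis
    using \<open>a < (a + b) * t\<close> deg[of 0] deg[of a] deg a b by (fastforce simp: image_iff)
qed

section \<open>Choice of parameters and the infinite family\<close>

lemma graph_isomorphic_imp_card_eq:
  assumes "graph_isomorphic G H"
  shows "card (pverts G) = card (pverts H)"
proof -
  obtain h where h: "pre_digraph.digraph_isomorphism (with_proj G) h"
    and H: "with_proj H = app_iso h (with_proj G)"
    using assms by (auto simp: graph_isomorphic_def digraph_iso_def)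
  have "pverts H = iso_verts h ` pverts G"
    using arg_cong[OF H, of verts] by simp
  moreover have "inj_on (iso_verts h) (pverts G)"
    using h by (simp add: pre_digraph.digraph_isomorphism_def)
  ultimately show ?thesis
    by (simp add: card_image)
qed

lemma degree_splitting:
  fixes k \<delta> \<Delta> :: int
  assumes "k \<ge> 1" and "\<delta> \<ge> k + 2" and "\<Delta> \<ge> \<delta>"
  obtains a b c d :: nat where "0 < a" "0 < b" "0 < c" "0 < d"
    and "2 * int a = \<delta> + k + 1 - parity_ind k \<delta>" and "2 * int b = \<Delta> - k - 1 + parity_ind k \<Delta>"
    and "int a + int c = \<delta>" and "int b + int d = \<Delta>"
    and "k \<le> int a - int c" "int a - int c \<le> k + 1"
    and "k \<le> int d - int b" "int d - int b \<le> k + 1"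
proof -
  have half: "2 * ((n + k + 1 - parity_ind k n) div 2) = n + k + 1 - parity_ind k n"
    and I: "parity_ind k n = 0 \<or> parity_ind k n = 1" for n
    unfolding parity_ind_def cong_def by presburger+
  \<comment> \<open>These are \<open>(\<delta> + k) / 2\<close> and
    \<open>(\<Delta> + k) / 2\<close> rounded up, to serve as \<open>a\<close> and \<open>d\<close>.
    As \<open>\<delta> \<ge> k + 2\<close>,
    \<open>2 * A \<le> \<delta> + k + 1 < 2 * \<delta>\<close>, which leaves
    \<open>c = \<delta> - A\<close> positive; similarly for \<open>b = \<Delta> - D\<close>.\<close>
  define A D where "A = (\<delta> + k + 1 - parity_ind k \<delta>) div 2" and "D = (\<Delta> + k + 1 - parity_ind k \<Delta>) div 2"
  have A: "2 * A = \<delta> + k + 1 - parity_ind k \<delta>" and D: "2 * D = \<Delta> + k + 1 - parity_ind k \<Delta>"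
    unfolding A_def D_def by (rule half)+
  note facts = A D I[of \<delta>] I[of \<Delta>] assms
  have parity: "parity_ind k (k + 2) = 1"
    by (simp add: parity_ind_def cong_def)
  have "parity_ind k \<delta> = 1" if "\<delta> = k + 2" using parity that by simp
  moreover have "parity_ind k \<Delta> = 1" if "\<Delta> = k + 2" using parity that by simp
  ultimately have "0 < A" "0 < D" "A < \<delta>" "D < \<Delta>"
    using facts by linarith+
  then show thesis
    using facts by (intro that[of "nat A" "nat (\<Delta> - D)" "nat (\<delta> - A)" "nat D"]) auto
qed

theorem theorem7:
  fixes k \<delta> \<Delta> :: int
  assumes "k \<ge> 1" and "\<delta> \<ge> k + 2" and "\<Delta> \<ge> \<delta>"
  shows "\<exists>\<F> :: nat pair_pre_digraph set.
    infinite \<F> \<and>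
    pairwise (\<lambda>G H. \<not> graph_isomorphic G H) \<F> \<and>
    (\<forall>G \<in> \<F>. pair_graph G \<and> pverts G \<noteq> {} \<and>
       int (min_degree G) = \<delta> \<and> int (max_degree G) = \<Delta> \<and>
       real_of_int (signed_total_domination_number k G) =
         real (card (pverts G)) *
         (real_of_int (\<delta> - \<Delta> + 2 * k + 2 - parity_ind k \<delta> - parity_ind k \<Delta>) /
          real_of_int (\<delta> + \<Delta> + parity_ind k \<Delta> - parity_ind k \<delta>)))"
proof -
  obtain a b c d :: nat where pos: "0 < a" "0 < b" "0 < c" "0 < d"
    and a: "2 * int a = \<delta> + k + 1 - parity_ind k \<delta>"
    and b: "2 * int b = \<Delta> - k - 1 + parity_ind k \<Delta>"
    and deg: "int a + int c = \<delta>" "int b + int d = \<Delta>"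
    and slack: "k \<le> int a - int c" "int a - int c \<le> k + 1"
      "k \<le> int d - int b" "int d - int b \<le> k + 1"
    using degree_splitting[OF assms] by metis
  \<comment> \<open>The factor \<open>2 * c * d\<close> makes the number of copies divisible by both
    block lengths; \<open>Suc r\<close> keeps it positive and gives distinct \<open>r\<close>
    distinct orders.\<close>
  define G where "G r = extremal_graph a b c d (2 * c * d * Suc r)" for r
  have le: "a + c \<le> b + d"
    using deg assms(3) by linarith
  have card_G: "card (pverts (G r)) = (a + b) * (2 * c * d) * Suc r" for r
    by (simp add: G_def algebra_simps)
  have G_eq: "r = s" if "card (pverts (G r)) = card (pverts (G s))" for r s
    using that pos by (simp add: card_G)
  have iso: "r = s" if "graph_isomorphic (G r) (G s)" for r s
    using graph_isomorphic_imp_card_eq[OF that] by (rule G_eq)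
  have "inj G"
    by (rule injI) (simp add: G_eq)
  have props: "pair_graph (G r)" "pverts (G r) \<noteq> {}"
      "int (min_degree (G r)) = \<delta>" "int (max_degree (G r)) = \<Delta>"
      "real_of_int (signed_total_domination_number k (G r)) =
         real (card (pverts (G r))) *
         (real_of_int (\<delta> - \<Delta> + 2 * k + 2 - parity_ind k \<delta> - parity_ind k \<Delta>) /
          real_of_int (\<delta> + \<Delta> + parity_ind k \<Delta> - parity_ind k \<delta>))" for r
  proof -
    define t where "t = 2 * c * d * Suc r"
    have t: "0 < t" "2 * c dvd t" "2 * d dvd t"
      using pos by (auto simp: t_def)
    have G: "G r = extremal_graph a b c d t"
      by (simp add: G_def t_def)
    have degs: "out_degree (with_proj (G r)) ` pverts (G r) = {a + c, b + d}"
      using degrees_extremal_graph[OF pos(1,2,3) t(2) pos(4) t(3,1)] by (simp add: G)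
    show "pair_graph (G r)"
      unfolding G by (rule pair_graph_extremal_graph)
    then interpret pair_graph "G r" .
    show "pverts (G r) \<noteq> {}"
      using degs by auto
    show "int (min_degree (G r)) = \<delta>" "int (max_degree (G r)) = \<Delta>"
      unfolding min_degree_def max_degree_def degs using le deg by auto
    have "signed_total_domination_number k (G r) * (int a + int b) =
        int (card (pverts (G r))) * (int a - int b)"
    proof (rule signed_total_domination_number_biregular)
      show "extremal_sign a b ` pverts (G r) \<subseteq> {-1, 1}"
        by (auto simp: extremal_sign_def)
    qed (use card_nbhd_with_extremal_graph[OF _ pos(3) t(2) pos(4) t(3)] le slack pos in
        \<open>auto simp: G\<close>)
    from arg_cong[OF this, of real_of_int]
    have "real_of_int (signed_total_domination_number k (G r)) * (real a + real b) =
        real (card (pverts (G r))) * (real a - real b)"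
      by simp
    \<comment> \<open>The fraction is doubled above and below because \<open>a\<close> and
      \<open>b\<close> are known through \<open>2 * int a\<close> and
      \<open>2 * int b\<close>.\<close>
    then have "real_of_int (signed_total_domination_number k (G r)) =
        real (card (pverts (G r))) * (real_of_int (2 * int a - 2 * int b) / real_of_int (2 * int a + 2 * int b))"
      using pos by (simp add: field_simps)
    moreover have "2 * int a - 2 * int b = \<delta> - \<Delta> + 2 * k + 2 - parity_ind k \<delta> - parity_ind k \<Delta>"
      and "2 * int a + 2 * int b = \<delta> + \<Delta> + parity_ind k \<Delta> - parity_ind k \<delta>"
      using a b by linarith+
    ultimately show "real_of_int (signed_total_domination_number k (G r)) =
         real (card (pverts (G r))) *
         (real_of_int (\<delta> - \<Delta> + 2 * k + 2 - parity_ind k \<delta> - parity_ind k \<Delta>) /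
          real_of_int (\<delta> + \<Delta> + parity_ind k \<Delta> - parity_ind k \<delta>))"
      by metis
  qed
  have "infinite (range G)"
    using \<open>inj G\<close> by (simp add: range_inj_infinite)
  moreover have "pairwise (\<lambda>G H. \<not> graph_isomorphic G H) (range G)"
    using iso by (auto simp: pairwise_def)
  ultimately show ?thesis
    using props by (intro exI[of _ "range G"]) blast
qed

end
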